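(* Let $f=f(x,y,p,q)$ be a smooth function on an open subset of $\mathbb{R}^4$, and let $\mathcal{S}$ be that open set equipped with the Riemannian metric $$g=dx^2+(dy-p\,dx)^2+(dp-q\,dx)^2+(dq-f\,dx)^2 .$$ Let $q=q(x,y,p)$ be a smooth function on an open subset of $\mathbb{R}^3$ such that the section $\sigma:(x,y,p)\mapsto (x,y,p,q(x,y,p))$ takes values in $\mathcal{S}$, and let $\widetilde{\mathcal{S}}\subset\mathcal{S}$ be the image of $\sigma$ with the induced metric. Assume that $f(x,y,p,q(x,y,p))=q_x+p\,q_y+q\,q_p$ identically, that $q_p=0$ identically, that $q_y\neq 0$ everywhere, and that $f_q=0$ at every point of $\widetilde{\mathcal{S}}$. Then $\widetilde{\mathcal{S}}$ is a minimal submanifold of $(\mathcal{S},g)$ if and only if $$q_{yy}=0$$ identically. Moreover, in this case the Gauss–Kronecker curvature of the minimal submanifold $\widetilde{\mathcal{S}}$ equals zero.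
   Context: Subscripts denote partial derivatives. The Riemannian manifold $(\mathcal{S},g)$ is associated with the third-order ODE $y'''=f(x,y,y',y'')$, where $p=y'$, $q=y''$; equivalently, $g=\sum_{i=1}^4\omega^i\otimes\omega^i$ with $\omega^1=dx$, $\omega^2=dy-p\,dx$, $\omega^3=dp-q\,dx$, $\omega^4=dq-f\,dx$. The submanifold $\widetilde{\mathcal{S}}$ corresponds to the second-order ODE $y''=q(x,y,y')$, and the condition $f(x,y,p,q(x,y,p))=q_x+pq_y+qq_p$ says that $y'''=f$ is the differential consequence of $y''=q$ along $\widetilde{\mathcal{S}}$. The symbol $q$ denotes both the fourth coordinate on $\mathcal{S}$ and the function defining $\sigma$; partial derivatives $q_x,q_y,q_p,q_{yy}$ refer to the function. $\widetilde{\mathcal{S}}$ is a three-dimensional hypersurface. Let $\mathbf{n}$ be a unit normal field, let $\mathcal{A}=(h_{ij})_{1\le i,j\le 3}$ be the Weingarten (shape) operator in the direction of $\mathbf{n}$, i.e. $\langle \mathcal{A}X,Y\rangle=\langle \mathrm{II}(X,Y),\mathbf{n}\rangle$, with $h_{ij}$ its components in an orthonormal tangent frame, where $\mathrm{II}$ is the second fundamental form. The mean curvature is $H=\frac13\operatorname{tr}\mathcal{A}$ and the Gauss–Kronecker curvature is $\det\mathcal{A}$. $\widetilde{\mathcal{S}}$ is called minimal if $H=0$ identically. *)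

theory Defs
  imports "HOL-Analysis.Analysis"
begin

primrec C_k_on ::
  "nat \<Rightarrow> ('a::euclidean_space \<Rightarrow> 'b::real_normed_vector) \<Rightarrow> 'a set \<Rightarrow> bool"
where
  "C_k_on 0 F S \<longleftrightarrow> continuous_on S F"
| "C_k_on (Suc k) F S \<longleftrightarrow>
     (\<forall>x\<in>S. F differentiable (at x)) \<and>
     (\<forall>v. C_k_on k (\<lambda>x. frechet_derivative F (at x) v) S)"

definition smooth_on :: "'a::euclidean_space set \<Rightarrow> ('a \<Rightarrow> 'b::real_normed_vector) \<Rightarrow> bool"
  where "smooth_on S F \<longleftrightarrow> (\<forall>k. C_k_on k F S)"

definition pd :: "'n::finite \<Rightarrow> (real^'n \<Rightarrow> 'b::real_normed_vector) \<Rightarrow> real^'n \<Rightarrow> 'b"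
  where "pd i F x = frechet_derivative F (at x) (axis i 1)"

subsection \<open>Riemannian geometry in a coordinate domain\<close>

text \<open>A metric on a domain of \<open>real^'n\<close> is given by its values \<open>g z u v\<close> on
  vectors \<open>u\<close>, \<open>v\<close> (in coordinate components) at the point \<open>z\<close>.\<close>

type_synonym 'n metric = "real^'n \<Rightarrow> real^'n \<Rightarrow> real^'n \<Rightarrow> real"

definition gram :: "'n::finite metric \<Rightarrow> real^'n \<Rightarrow> real^'n^'n"
  where "gram g z = (\<chi> i j. g z (axis i 1) (axis j 1))"

text \<open>\<open>christoffel g z k i j\<close> is the Levi-Civita coefficient with upper index \<open>k\<close>.\<close>

definition christoffel :: "'n::finite metric \<Rightarrow> real^'n \<Rightarrow> 'n \<Rightarrow> 'n \<Rightarrow> 'n \<Rightarrow> real"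
  where "christoffel g z k i j =
    (1/2) * (\<Sum>l\<in>UNIV. matrix_inv (gram g z) $ k $ l *
      (pd i (\<lambda>w. gram g w $ j $ l) z + pd j (\<lambda>w. gram g w $ i $ l) z
        - pd l (\<lambda>w. gram g w $ i $ j) z))"

text \<open>Immersed submanifolds are given by a parametrisation \<open>\<phi>\<close>, and tangent vectors of the
  submanifold are represented by vectors \<open>X\<close> of the parameter space, standing for
  \<open>dmap \<phi> u X\<close>.\<close>

definition dmap :: "(real^'m::finite \<Rightarrow> real^'n::finite) \<Rightarrow> real^'m \<Rightarrow> real^'m \<Rightarrow> real^'n"
  where "dmap \<phi> u X = frechet_derivative \<phi> (at u) X"

definition induced_metric ::
  "'n::finite metric \<Rightarrow> (real^'m::finite \<Rightarrow> real^'n) \<Rightarrow> 'm metric"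
  where "induced_metric g \<phi> u X Y = g (\<phi> u) (dmap \<phi> u X) (dmap \<phi> u Y)"

text \<open>Levi-Civita covariant derivative, in direction \<open>X\<close>, of a vector field \<open>V\<close> along \<open>\<phi>\<close>.\<close>

definition cov_deriv ::
  "'n::finite metric \<Rightarrow> (real^'m::finite \<Rightarrow> real^'n) \<Rightarrow> (real^'m \<Rightarrow> real^'n)
    \<Rightarrow> real^'m \<Rightarrow> real^'m \<Rightarrow> real^'n"
  where "cov_deriv g \<phi> V u X =
    frechet_derivative V (at u) X +
    (\<chi> k. \<Sum>i\<in>UNIV. \<Sum>j\<in>UNIV. christoffel g (\<phi> u) k i j * dmap \<phi> u X $ i * V u $ j)"

definition normal_at ::
  "'n::finite metric \<Rightarrow> (real^'m::finite \<Rightarrow> real^'n) \<Rightarrow> real^'m \<Rightarrow> real^'n \<Rightarrow> bool"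
  where "normal_at g \<phi> u N \<longleftrightarrow> (\<forall>X. g (\<phi> u) N (dmap \<phi> u X) = 0)"

definition normal_part ::
  "'n::finite metric \<Rightarrow> (real^'m::finite \<Rightarrow> real^'n) \<Rightarrow> real^'m \<Rightarrow> real^'n \<Rightarrow> real^'n"
  where "normal_part g \<phi> u W =
    (THE N. normal_at g \<phi> u N \<and> W - N \<in> range (dmap \<phi> u))"

text \<open>The tangent vector \<open>Y\<close> is extended to the tangent field \<open>v \<mapsto> dmap \<phi> v Y\<close> with
  constant coefficients; the normal part does not depend on the extension.\<close>

definition second_fundamental_form ::
  "'n::finite metric \<Rightarrow> (real^'m::finite \<Rightarrow> real^'n) \<Rightarrow> real^'m \<Rightarrow> real^'m \<Rightarrow> real^'m \<Rightarrow> real^'n"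
  where "second_fundamental_form g \<phi> u X Y =
    normal_part g \<phi> u (cov_deriv g \<phi> (\<lambda>v. dmap \<phi> v Y) u X)"

definition unit_normal_field ::
  "'n::finite metric \<Rightarrow> (real^'m::finite \<Rightarrow> real^'n) \<Rightarrow> (real^'m) set
    \<Rightarrow> (real^'m \<Rightarrow> real^'n) \<Rightarrow> bool"
  where "unit_normal_field g \<phi> U n \<longleftrightarrow>
    smooth_on U n \<and> (\<forall>u\<in>U. normal_at g \<phi> u (n u) \<and> g (\<phi> u) (n u) (n u) = 1)"

text \<open>Since the induced metric is positive definite, the operator is uniquely determined.
  Its trace and determinant, computed below in the coordinate frame, do not depend on the
  frame, so they are those of the matrix \<open>(h\<^sub>i\<^sub>j)\<close> in an orthonormal tangent frame.\<close>

definition shape_operator ::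
  "'n::finite metric \<Rightarrow> (real^'m::finite \<Rightarrow> real^'n) \<Rightarrow> (real^'m \<Rightarrow> real^'n)
    \<Rightarrow> real^'m \<Rightarrow> real^'m \<Rightarrow> real^'m"
  where "shape_operator g \<phi> n u =
    (THE A. linear A \<and>
      (\<forall>X Y. induced_metric g \<phi> u (A X) Y = g (\<phi> u) (second_fundamental_form g \<phi> u X Y) (n u)))"

definition mean_curvature ::
  "'n::finite metric \<Rightarrow> (real^'m::finite \<Rightarrow> real^'n) \<Rightarrow> (real^'m \<Rightarrow> real^'n) \<Rightarrow> real^'m \<Rightarrow> real"
  where "mean_curvature g \<phi> n u = trace (matrix (shape_operator g \<phi> n u)) / real CARD('m)"

definition gauss_kronecker ::
  "'n::finite metric \<Rightarrow> (real^'m::finite \<Rightarrow> real^'n) \<Rightarrow> (real^'m \<Rightarrow> real^'n) \<Rightarrow> real^'m \<Rightarrow> real"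
  where "gauss_kronecker g \<phi> n u = det (matrix (shape_operator g \<phi> n u))"

definition minimal_hypersurface ::
  "'n::finite metric \<Rightarrow> (real^'m::finite \<Rightarrow> real^'n) \<Rightarrow> (real^'m) set
    \<Rightarrow> (real^'m \<Rightarrow> real^'n) \<Rightarrow> bool"
  where "minimal_hypersurface g \<phi> U n \<longleftrightarrow> (\<forall>u\<in>U. mean_curvature g \<phi> n u = 0)"

subsection \<open>The metric of a third-order ODE and the section of a second-order ODE\<close>

text \<open>Points of \<open>real^4\<close> are \<open>(x, y, p, q)\<close> and points of \<open>real^3\<close> are \<open>(x, y, p)\<close>;
  \<open>coframe f z w\<close> lists the values of \<open>dx\<close>, \<open>dy - p dx\<close>, \<open>dp - q dx\<close>, \<open>dq - f dx\<close> at \<open>z\<close>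
  on the vector \<open>w\<close>.\<close>

definition coframe :: "(real^4 \<Rightarrow> real) \<Rightarrow> real^4 \<Rightarrow> real^4 \<Rightarrow> real^4"
  where "coframe f z w =
    vector [w$1, w$2 - z$3 * w$1, w$3 - z$4 * w$1, w$4 - f z * w$1]"

definition ode_metric :: "(real^4 \<Rightarrow> real) \<Rightarrow> 4 metric"
  where "ode_metric f z v w = (\<Sum>i\<in>UNIV. coframe f z v $ i * coframe f z w $ i)"

definition ode_section :: "(real^3 \<Rightarrow> real) \<Rightarrow> real^3 \<Rightarrow> real^4"
  where "ode_section q u = vector [u$1, u$2, u$3, q u]"

lemma vector_4_nth [simp]:
  fixes a b c d :: "'a::zero"
  shows "(vector [a, b, c, d] :: 'a^4) $ 1 = a"
    and "(vector [a, b, c, d] :: 'a^4) $ 2 = b"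
    and "(vector [a, b, c, d] :: 'a^4) $ 3 = c"
    and "(vector [a, b, c, d] :: 'a^4) $ 4 = d"
  unfolding vector_def by simp_all

end

theory Submission
  imports Defs
begin

text \<open>
  Along the hypersurface put \<open>s = q\<^sub>y\<close>. Since \<open>f = q\<^sub>x + p q\<^sub>y + q q\<^sub>p\<close> there, the vector
  \<open>\<partial>\<^sub>x + p \<partial>\<^sub>y + q \<partial>\<^sub>p + f \<partial>\<^sub>q\<close> is tangent. It is the image of \<open>F = (1, p, q)\<close>, and with
  \<open>q\<^sub>p = 0\<close> the fields \<open>F\<close>, \<open>\<partial>\<^sub>y / sqrt (1 + s\<^sup>2)\<close>, \<open>\<partial>\<^sub>p\<close> of the parameter space are
  orthonormal for the induced metric, while a unit normal is
  \<open>\<nu> (\<partial>\<^sub>q - s \<partial>\<^sub>y)\<close> with \<open>\<nu> \<noteq> 0\<close>.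

  The metric depends on the point only through the coefficients of \<open>dx\<close> in the coframe, and \<open>dx\<close>
  vanishes on the normal. Hence, in the Koszul formula (lemma \<open>christoffel_lowered\<close>), the
  second fundamental form paired with the normal reduces on the plane of \<open>\<partial>\<^sub>y\<close> and \<open>\<partial>\<^sub>p\<close> to \<open>\<nu>\<close>
  times the Hessian of \<open>q\<close> (lemma \<open>second_form_ode_section\<close>). Since \<open>q\<close> is locally independent of
  \<open>p\<close>, its only entry there is \<open>\<nu> q\<^sub>y\<^sub>y\<close>, at \<open>(\<partial>\<^sub>y, \<partial>\<^sub>y)\<close>. The entry at \<open>(F, F)\<close> vanishes: it is
  the defect in the relation obtained by differentiating \<open>f \<circ> \<sigma> = q\<^sub>x + p q\<^sub>y\<close> along \<open>F\<close>.

  Taking the trace in the orthonormal frame, the mean curvature is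
  \<open>\<nu> q\<^sub>y\<^sub>y / (3 (1 + s\<^sup>2))\<close> (lemma \<open>ode_section_curvature\<close>), so minimality means
  \<open>q\<^sub>y\<^sub>y = 0\<close>. In that case the second fundamental form vanishes on the whole plane of \<open>\<partial>\<^sub>y\<close> and
  \<open>\<partial>\<^sub>p\<close>; the shape operator maps this plane into the line of \<open>F\<close> and its determinant is zero
  (lemma \<open>shape_operator_adapted_frame\<close>).
\<close>

section \<open>Lowered Christoffel symbols\<close>

lemma linear_axis_expansion:
  fixes h :: "real^'n::finite \<Rightarrow> 'b::real_vector"
  assumes "linear h"
  shows "h a = (\<Sum>i\<in>UNIV. a $ i *\<^sub>R h (axis i 1))"
proof -
  have "h a = h (\<Sum>i\<in>UNIV. a $ i *\<^sub>R axis i 1)"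
    using basis_expansion[of a] by (simp add: scalar_mult_eq_scaleR)
  also have "\<dots> = (\<Sum>i\<in>UNIV. a $ i *\<^sub>R h (axis i 1))"
    by (simp add: linear_sum[OF assms] linear_cmul[OF assms])
  finally show ?thesis .
qed

lemma bilinear_axis_expansion:
  fixes h :: "real^'n::finite \<Rightarrow> real^'m::finite \<Rightarrow> 'b::real_vector"
  assumes "bilinear h"
  shows "h a b = (\<Sum>i\<in>UNIV. \<Sum>j\<in>UNIV. (a $ i * b $ j) *\<^sub>R h (axis i 1) (axis j 1))"
proof -
  have l: "linear (\<lambda>x. h x y)" and r: "linear (h x)" for x y
    using assms by (auto simp: bilinear_def)
  have "h a b = (\<Sum>i\<in>UNIV. a $ i *\<^sub>R h (axis i 1) b)"
    by (rule linear_axis_expansion[OF l])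
  also have "\<dots> = (\<Sum>i\<in>UNIV. \<Sum>j\<in>UNIV. (a $ i * b $ j) *\<^sub>R h (axis i 1) (axis j 1))"
    by (subst linear_axis_expansion[OF r]) (simp add: scaleR_sum_right)
  finally show ?thesis .
qed

lemma gram_inner:
  assumes "bilinear (g z)" and sym: "\<And>v w. g z v w = g z w v"
  shows "g z v w = (gram g z *v v) \<bullet> w"
proof -
  have "g z v w = g z w v" by (rule sym)
  also have "\<dots> = (\<Sum>i\<in>UNIV. \<Sum>j\<in>UNIV. (w $ i * v $ j) * g z (axis i 1) (axis j 1))"
    by (subst bilinear_axis_expansion[OF assms(1)]) simp
  also have "\<dots> = (gram g z *v v) \<bullet> w"
    by (simp add: inner_vec_def matrix_vector_mult_def gram_def sum_distrib_right sum_distrib_left mult_ac)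
  finally show ?thesis .
qed

text \<open>Definiteness makes the kernel of the Gram matrix trivial, so that the choice
  in \<open>matrix_inv\<close> is made among actual inverses.\<close>
lemma gram_inverse:
  assumes "bilinear (g z)" and "\<And>v w. g z v w = g z w v"
    and pos: "\<And>v. v \<noteq> 0 \<Longrightarrow> g z v v > 0"
  shows "gram g z ** matrix_inv (gram g z) = mat 1"
proof -
  have "v = 0" if "gram g z *v v = 0" for v
    using gram_inner[of g z, OF assms(1,2), of v v] pos[of v] that by auto
  then have "invertible (gram g z)"
    unfolding invertible_left_inverse matrix_left_invertible_ker by blast
  then show ?thesis
    unfolding invertible_def matrix_inv_def by (rule someI2_ex) simp
qed

text \<open>The coordinate form of the Koszul formula. Pairing the Christoffel vector with a third vector
  cancels the inverse Gram matrix in the definition of \<open>christoffel\<close>, so that the Levi-Civita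
  connection can be used knowing only the derivatives \<open>G a b c\<close> of the functions \<open>g b c\<close> in
  the directions \<open>a\<close>, and the inverse never has to be computed.\<close>
lemma christoffel_lowered:
  fixes g :: "'n::finite metric"
  assumes bil: "bilinear (g z)" and sym: "\<And>v w. g z v w = g z w v"
    and pos: "\<And>v. v \<noteq> 0 \<Longrightarrow> g z v v > 0"
    and der: "\<And>b c. ((\<lambda>w. g w b c) has_derivative (\<lambda>a. G a b c)) (at z)"
    and bilG: "\<And>a. bilinear (G a)"
  shows "g z (\<chi> k. \<Sum>i\<in>UNIV. \<Sum>j\<in>UNIV. christoffel g z k i j * a $ i * b $ j) c =
    (G a b c + G b a c - G c a b) / 2"
proof -
  define M where "M = matrix_inv (gram g z)"
  define e :: "'n \<Rightarrow> real^'n" where "e i = axis i 1" for i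
  define T where "T = (\<lambda>c. (G a b c + G b a c - G c a b) / 2)"
  have lin1: "linear (\<lambda>a. G a b c)" for b c
    using der has_derivative_linear by blast
  have lin2: "linear (\<lambda>b. G a b c)" and lin3: "linear (\<lambda>c. G a b c)" for a b c
    using bilG by (auto simp: bilinear_def)
  have bil12: "bilinear (\<lambda>a b. G a b c)" for c
    using lin1 lin2 by (auto simp: bilinear_def)
  have bil21: "bilinear (\<lambda>a b. G b a c)" for c
    using lin1 lin2 by (auto simp: bilinear_def)
  have pd_gram: "pd i (\<lambda>w. gram g w $ j $ l) z = G (e i) (e j) (e l)" for i j l
    unfolding pd_def gram_def e_def using frechet_derivative_at[OF der, symmetric] by simp
  have bilT: "bilinear (\<lambda>a b. (G a b c + G b a c - G c a b) / 2)" for c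
    using bil12[of c] bil21[of c] bilG[of c]
    by (simp add: bilinear_def linear_iff algebra_simps add_divide_distrib diff_divide_distrib)
  have T_sum: "T (e l) = (\<Sum>i\<in>UNIV. \<Sum>j\<in>UNIV. a $ i * b $ j *
      ((G (e i) (e j) (e l) + G (e j) (e i) (e l) - G (e l) (e i) (e j)) / 2))" for l
    unfolding T_def e_def
    by (subst bilinear_axis_expansion[OF bilT]) simp
  have chr: "christoffel g z k i j = (\<Sum>l\<in>UNIV. M $ k $ l *
      ((G (e i) (e j) (e l) + G (e j) (e i) (e l) - G (e l) (e i) (e j)) / 2))" for k i j
    unfolding christoffel_def M_def[symmetric] pd_gram
    by (simp add: sum_distrib_left sum_divide_distrib)
  have "(\<Sum>i\<in>UNIV. \<Sum>j\<in>UNIV. christoffel g z k i j * a $ i * b $ j) =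
      (M *v (\<chi> l. T (e l))) $ k" for k
  proof -
    have "(\<Sum>i\<in>UNIV. \<Sum>j\<in>UNIV. christoffel g z k i j * a $ i * b $ j) =
      (\<Sum>i\<in>UNIV. \<Sum>j\<in>UNIV. \<Sum>l\<in>UNIV. M $ k $ l * (a $ i * b $ j *
      ((G (e i) (e j) (e l) + G (e j) (e i) (e l) - G (e l) (e i) (e j)) / 2)))"
      unfolding chr sum_distrib_right by (intro sum.cong refl) (simp only: mult_ac)
    also have "\<dots> = (\<Sum>i\<in>UNIV. \<Sum>l\<in>UNIV. \<Sum>j\<in>UNIV. M $ k $ l * (a $ i * b $ j *
      ((G (e i) (e j) (e l) + G (e j) (e i) (e l) - G (e l) (e i) (e j)) / 2)))"
      by (intro sum.cong refl sum.swap)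
    also have "\<dots> = (\<Sum>l\<in>UNIV. \<Sum>i\<in>UNIV. \<Sum>j\<in>UNIV. M $ k $ l * (a $ i * b $ j *
      ((G (e i) (e j) (e l) + G (e j) (e i) (e l) - G (e l) (e i) (e j)) / 2)))"
      by (rule sum.swap)
    also have "\<dots> = (M *v (\<chi> l. T (e l))) $ k"
      by (simp add: matrix_vector_mult_def T_sum sum_distrib_left)
    finally show ?thesis .
  qed
  then have "(\<chi> k. \<Sum>i\<in>UNIV. \<Sum>j\<in>UNIV. christoffel g z k i j * a $ i * b $ j) =
      M *v (\<chi> l. T (e l))"
    by (simp add: vec_eq_iff)
  then have "g z (\<chi> k. \<Sum>i\<in>UNIV. \<Sum>j\<in>UNIV. christoffel g z k i j * a $ i * b $ j) c =
      (\<chi> l. T (e l)) \<bullet> c"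
    by (simp add: gram_inner[of g z, OF bil sym] matrix_vector_mul_assoc
        gram_inverse[of g z, OF bil sym pos] M_def)
  also have "\<dots> = T c"
  proof -
    have "linear T"
      unfolding T_def using lin1 lin3
      by (simp add: linear_iff algebra_simps add_divide_distrib diff_divide_distrib)
    from linear_axis_expansion[OF this, of c] show ?thesis
      by (simp add: inner_vec_def e_def mult_ac)
  qed
  finally show ?thesis by (simp add: T_def)
qed

section \<open>Hypersurfaces\<close>

text \<open>In codimension one the normal part is the orthogonal projection onto a unit normal. The
  codimension enters as the hypothesis that everything orthogonal to \<open>n\<close> is tangent.\<close>
lemma normal_part_hypersurface:
  assumes bil: "bilinear (g (\<phi> u))" and sym: "\<And>v w. g (\<phi> u) v w = g (\<phi> u) w v"
    and pos: "\<And>v. v \<noteq> 0 \<Longrightarrow> g (\<phi> u) v v > 0"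
    and lin: "linear (dmap \<phi> u)"
    and n: "normal_at g \<phi> u n" "g (\<phi> u) n n = 1"
    and codim: "\<And>W. g (\<phi> u) W n = 0 \<Longrightarrow> W \<in> range (dmap \<phi> u)"
  shows "normal_part g \<phi> u W = g (\<phi> u) W n *\<^sub>R n"
  unfolding normal_part_def
proof (rule the_equality)
  let ?N = "g (\<phi> u) W n *\<^sub>R n"
  have normal: "normal_at g \<phi> u ?N"
    using n(1) by (simp add: normal_at_def bilinear_lmul[OF bil])
  have tangent: "W - ?N \<in> range (dmap \<phi> u)"
    by (rule codim) (simp add: bilinear_lsub[OF bil] bilinear_lmul[OF bil] n(2))
  show "normal_at g \<phi> u ?N \<and> W - ?N \<in> range (dmap \<phi> u)"
    using normal tangent by simp
  fix N assume N: "normal_at g \<phi> u N \<and> W - N \<in> range (dmap \<phi> u)"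
  then obtain X Y where "W - N = dmap \<phi> u X" "W - ?N = dmap \<phi> u Y"
    using tangent by blast
  then have "N - ?N = dmap \<phi> u (Y - X)"
    by (simp add: linear_diff[OF lin] algebra_simps)
  moreover have "normal_at g \<phi> u (N - ?N)"
    using N normal by (simp add: normal_at_def bilinear_lsub[OF bil])
  ultimately have "g (\<phi> u) (N - ?N) (N - ?N) = 0"
    by (simp add: normal_at_def)
  then show "N = ?N"
    using pos[of "N - ?N"] by force
qed

lemma shape_operator_eqI:
  assumes bil: "bilinear (induced_metric g \<phi> u)"
    and pos: "\<And>X. X \<noteq> 0 \<Longrightarrow> induced_metric g \<phi> u X X > 0"
    and lin: "linear A"
    and A: "\<And>X Y. induced_metric g \<phi> u (A X) Y = g (\<phi> u) (second_fundamental_form g \<phi> u X Y) (n u)"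
  shows "shape_operator g \<phi> n u = A"
  unfolding shape_operator_def
proof (rule the_equality)
  show "linear A \<and> (\<forall>X Y. induced_metric g \<phi> u (A X) Y =
      g (\<phi> u) (second_fundamental_form g \<phi> u X Y) (n u))"
    using lin A by blast
  fix B assume B: "linear B \<and> (\<forall>X Y. induced_metric g \<phi> u (B X) Y =
      g (\<phi> u) (second_fundamental_form g \<phi> u X Y) (n u))"
  show "B = A"
  proof
    fix X
    have "induced_metric g \<phi> u (B X - A X) (B X - A X) = 0"
      using A B by (simp add: bilinear_lsub[OF bil])
    then show "B X = A X"
      using pos[of "B X - A X"] by force
  qed
qed

section \<open>The metric of the third-order ODE\<close>

lemma has_derivative_vector_4:
  fixes f1 f2 f3 f4 :: "'a::real_normed_vector \<Rightarrow> real"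
  assumes "(f1 has_derivative f1') F" "(f2 has_derivative f2') F"
    "(f3 has_derivative f3') F" "(f4 has_derivative f4') F"
  shows "((\<lambda>x. vector [f1 x, f2 x, f3 x, f4 x] :: real^4) has_derivative
    (\<lambda>h. vector [f1' h, f2' h, f3' h, f4' h])) F"
proof -
  have vec: "(vector [a, b, c, d] :: real^4) =
      a *\<^sub>R axis 1 1 + b *\<^sub>R axis 2 1 + c *\<^sub>R axis 3 1 + d *\<^sub>R axis 4 1" for a b c d
    by (simp add: vec_eq_iff forall_4 axis_def)
  show ?thesis
    unfolding vec by (intro has_derivative_add has_derivative_scaleR_left assms)
qed

lemma has_derivative_nth: "((\<lambda>v::real^'n. v $ i) has_derivative (\<lambda>h. h $ i)) F"
  by (rule bounded_linear_imp_has_derivative[OF bounded_linear_vec_nth])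

lemma ode_metric_eq:
  "ode_metric f z v w = v$1 * w$1 + (v$2 - z$3 * v$1) * (w$2 - z$3 * w$1)
    + (v$3 - z$4 * v$1) * (w$3 - z$4 * w$1) + (v$4 - f z * v$1) * (w$4 - f z * w$1)"
  by (simp add: ode_metric_def coframe_def sum_4)

lemma bilinear_ode_metric: "bilinear (ode_metric f z)"
  by (simp add: bilinear_def linear_iff ode_metric_eq algebra_simps)

lemma ode_metric_sym: "ode_metric f z v w = ode_metric f z w v"
  by (simp add: ode_metric_def mult.commute)

lemma ode_metric_pos: "v \<noteq> 0 \<Longrightarrow> ode_metric f z v v > 0"
proof -
  assume "v \<noteq> 0"
  have "ode_metric f z v v = (norm (coframe f z v))\<^sup>2"
    by (simp add: ode_metric_def power2_norm_eq_inner inner_vec_def)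
  moreover have "coframe f z v \<noteq> 0"
    using \<open>v \<noteq> 0\<close> by (auto simp: vec_eq_iff forall_4 coframe_def)
  ultimately show ?thesis by simp
qed

text \<open>The derivative at \<open>z\<close> in direction \<open>a\<close> of the coframe on a constant vector \<open>b\<close> is
  \<open>(0, - a$3 * b$1, - a$4 * b$1, - f' a * b$1)\<close>; the product rule gives the derivative of the
  metric. Every term contains the first component of \<open>b\<close> or of \<open>c\<close>, which is why
  most terms of the Koszul formula vanish for vectors annihilated by \<open>dx\<close>.\<close>

definition ode_metric_deriv ::
  "(real^4 \<Rightarrow> real) \<Rightarrow> (real^4 \<Rightarrow> real) \<Rightarrow> real^4 \<Rightarrow> real^4 \<Rightarrow> real^4 \<Rightarrow> real^4 \<Rightarrow> real"
  where "ode_metric_deriv f f' z a b c =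
    - (a$3 * (b$1 * coframe f z c $ 2 + c$1 * coframe f z b $ 2)
     + a$4 * (b$1 * coframe f z c $ 3 + c$1 * coframe f z b $ 3)
     + f' a * (b$1 * coframe f z c $ 4 + c$1 * coframe f z b $ 4))"

lemma has_derivative_ode_metric:
  assumes "(f has_derivative f') (at z)"
  shows "((\<lambda>w. ode_metric f w b c) has_derivative (\<lambda>a. ode_metric_deriv f f' z a b c)) (at z)"
  unfolding ode_metric_eq ode_metric_deriv_def coframe_def
  by (rule derivative_eq_intros has_derivative_nth assms refl)+
     (auto simp: algebra_simps fun_eq_iff)

lemma bilinear_ode_metric_deriv: "bilinear (ode_metric_deriv f f' z a)"
  by (simp add: bilinear_def linear_iff ode_metric_deriv_def coframe_def algebra_simps)

section \<open>The section and its second fundamental form\<close>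

lemma has_derivative_ode_section:
  assumes "(q has_derivative q') (at u)"
  shows "(ode_section q has_derivative (\<lambda>X. vector [X$1, X$2, X$3, q' X])) (at u)"
  unfolding ode_section_def
  by (intro has_derivative_vector_4 has_derivative_nth assms)

lemma dmap_ode_section:
  assumes "(q has_derivative q') (at u)"
  shows "dmap (ode_section q) u X = vector [X$1, X$2, X$3, q' X]"
  unfolding dmap_def frechet_derivative_at[OF has_derivative_ode_section[OF assms], symmetric] ..

lemma linear_dmap_ode_section:
  assumes "(q has_derivative q') (at u)"
  shows "linear (dmap (ode_section q) u)"
  using linear_frechet_derivative[of "ode_section q" "at u"] has_derivative_ode_section[OF assms]
  unfolding dmap_def differentiable_def by auto

text \<open>The hypothesis on the derivative of \<open>q\<close> encodes \<open>q\<^sub>x = r\<close>, \<open>q\<^sub>y = s\<close> and \<open>q\<^sub>p = 0\<close>. Then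
  \<open>f = r + p * s\<close> says that \<open>e = \<partial>\<^sub>x + p \<partial>\<^sub>y + q \<partial>\<^sub>p + f \<partial>\<^sub>q\<close> is tangent to the section. Orthogonality
  to \<open>e\<close>, on which the coframe is \<open>(1, 0, 0, 0)\<close>, and to the images of \<open>\<partial>\<^sub>y\<close> and \<open>\<partial>\<^sub>p\<close>
  leaves the multiples of \<open>\<partial>\<^sub>q - s \<partial>\<^sub>y\<close>.\<close>
lemma normal_ode_section:
  fixes u :: "real^3" and n :: "real^4"
  assumes q: "(q has_derivative (\<lambda>X. r * X$1 + s * X$2)) (at u)"
    and tangency: "f (ode_section q u) = r + u$3 * s"
    and n: "normal_at (ode_metric f) (ode_section q) u n"
  shows "n = vector [0, - (n$4 * s), 0, n$4]"
proof -
  have "ode_metric f (ode_section q u) n (dmap (ode_section q) u X) = 0" for X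
    using n by (simp add: normal_at_def)
  note N = this[unfolded dmap_ode_section[OF q] ode_metric_eq]
  have 1: "n$1 = 0"
    using N[of "vector [1, u$3, q u]"] tangency by (simp add: ode_section_def algebra_simps)
  have 2: "n$2 + n$4 * s = 0"
    using N[of "axis 2 1"] 1 by (simp add: axis_def)
  have 3: "n$3 = 0"
    using N[of "axis 3 1"] 1 by (simp add: axis_def)
  show ?thesis
    using 1 2 3 by (simp add: vec_eq_iff forall_4)
qed

lemma induced_metric_ode_section:
  fixes u :: "real^3"
  assumes q: "(q has_derivative (\<lambda>X. r * X$1 + s * X$2)) (at u)"
    and tangency: "f (ode_section q u) = r + u$3 * s"
  shows "induced_metric (ode_metric f) (ode_section q) u X Y =
    X$1 * Y$1 + (1 + s\<^sup>2) * ((X$2 - u$3 * X$1) * (Y$2 - u$3 * Y$1))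
    + (X$3 - q u * X$1) * (Y$3 - q u * Y$1)"
  unfolding induced_metric_def dmap_ode_section[OF q] ode_metric_eq tangency
  by (simp add: ode_section_def algebra_simps power2_eq_square)

text \<open>By \<open>christoffel_lowered\<close> the pairing is the flat second derivative of the section, weighted
  by \<open>n$4\<close>, plus half of the Koszul terms. The linear forms \<open>R\<close> and \<open>T\<close> are the differentials of
  \<open>q\<^sub>x\<close> and \<open>q\<^sub>y\<close>; when \<open>q\<^sub>p\<close> vanishes near \<open>u\<close>, as \<open>dV\<close> presupposes, they carry the whole
  Hessian of \<open>q\<close>. All Koszul terms have a factor \<open>X$1\<close> or \<open>Y$1\<close>: on vectors annihilated by
  \<open>dx\<close> only the Hessian remains.\<close>
lemma second_form_ode_section:
  fixes u :: "real^3" and n :: "real^4"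
  assumes q: "(q has_derivative (\<lambda>X. r * X$1 + s * X$2)) (at u)"
    and dV: "\<And>Y. ((\<lambda>v. dmap (ode_section q) v Y) has_derivative
      (\<lambda>X. vector [0, 0, 0, R X * Y$1 + T X * Y$2])) (at u)"
    and f: "(f has_derivative f') (at (ode_section q u))"
    and tangency: "f (ode_section q u) = r + u$3 * s"
    and n: "normal_at (ode_metric f) (ode_section q) u n"
      "ode_metric f (ode_section q u) n n = 1"
  shows "ode_metric f (ode_section q u)
      (second_fundamental_form (ode_metric f) (ode_section q) u X Y) n =
    n$4 * (R X * Y$1 + T X * Y$2)
    + (n$4 * (Y$1 * (s * X$3 - f' (dmap (ode_section q) u X))
            + X$1 * (s * Y$3 - f' (dmap (ode_section q) u Y))
            + X$1 * (Y$3 - q u * Y$1) + Y$1 * (X$3 - q u * X$1))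
       + f' n * s * (X$1 * (Y$2 - u$3 * Y$1) + Y$1 * (X$2 - u$3 * X$1))) / 2"
proof -
  let ?g = "ode_metric f" and ?\<phi> = "ode_section q"
  let ?W = "cov_deriv ?g ?\<phi> (\<lambda>v. dmap ?\<phi> v Y) u X"
  let ?a = "dmap ?\<phi> u X" and ?b = "dmap ?\<phi> u Y"
  have nvec: "n = vector [0, - (n$4 * s), 0, n$4]"
    using q tangency n(1) by (rule normal_ode_section)
  have n1: "n$1 = 0" "n$2 = - (n$4 * s)" "n$3 = 0"
    by (subst nvec, simp)+
  have codim: "W \<in> range (dmap ?\<phi> u)" if "?g (?\<phi> u) W n = 0" for W
  proof -
    \<comment> \<open>Up to the factor \<open>n$4\<close>, orthogonality to \<open>n\<close> is the equation
      \<open>W$4 = q\<^sub>x W$1 + q\<^sub>y W$2\<close> of the tangent space.\<close>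
    have "n$4 * ((W$4 - (r + u$3 * s) * W$1) - s * (W$2 - u$3 * W$1)) = 0"
      using that tangency by (simp add: ode_metric_eq n1 ode_section_def algebra_simps)
    moreover have "n$4 \<noteq> 0"
      using n(2) by (auto simp: ode_metric_eq n1)
    ultimately have "(W$4 - (r + u$3 * s) * W$1) - s * (W$2 - u$3 * W$1) = 0"
      by simp
    then have "W$4 = r * W$1 + s * W$2"
      by (simp add: algebra_simps)
    then have "W = dmap ?\<phi> u (vector [W$1, W$2, W$3])"
      by (simp add: dmap_ode_section[OF q] vec_eq_iff forall_4)
    then show ?thesis by blast
  qed
  have "?g (?\<phi> u) (second_fundamental_form ?g ?\<phi> u X Y) n = ?g (?\<phi> u) ?W n"
    unfolding second_fundamental_form_def
    by (subst normal_part_hypersurface[of ?g ?\<phi> u n, OF bilinear_ode_metric ode_metric_sym ode_metric_pos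
        linear_dmap_ode_section[OF q] n codim])
      (simp_all add: bilinear_lmul[OF bilinear_ode_metric] n(2))
  also have "\<dots> = ?g (?\<phi> u) (vector [0, 0, 0, R X * Y$1 + T X * Y$2]) n
      + (ode_metric_deriv f f' (?\<phi> u) ?a ?b n + ode_metric_deriv f f' (?\<phi> u) ?b ?a n
        - ode_metric_deriv f f' (?\<phi> u) n ?a ?b) / 2"
    unfolding cov_deriv_def bilinear_ladd[OF bilinear_ode_metric]
      frechet_derivative_at[OF dV, symmetric]
    by (subst christoffel_lowered[of ?g "?\<phi> u", OF bilinear_ode_metric ode_metric_sym ode_metric_pos
        has_derivative_ode_metric[OF f] bilinear_ode_metric_deriv]) simp_all
  also have "\<dots> = n$4 * (R X * Y$1 + T X * Y$2)
    + (n$4 * (Y$1 * (s * X$3 - f' ?a) + X$1 * (s * Y$3 - f' ?b)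
            + X$1 * (Y$3 - q u * Y$1) + Y$1 * (X$3 - q u * X$1))
       + f' n * s * (X$1 * (Y$2 - u$3 * Y$1) + Y$1 * (X$2 - u$3 * X$1))) / 2"
    unfolding ode_metric_deriv_def ode_metric_eq coframe_def
    by (simp add: dmap_ode_section[OF q] n1 tangency)
       (simp add: ode_section_def algebra_simps)
  finally show ?thesis .
qed

section \<open>The shape operator in the adapted frame\<close>

text \<open>The form of the induced metric says that \<open>F = (1, p, q)\<close>, \<open>\<partial>\<^sub>y / sqrt (1 + s\<^sup>2)\<close> and
  \<open>\<partial>\<^sub>p\<close> are an orthonormal frame \<open>F\<^sub>i\<close>. The shape operator is therefore
  \<open>A X = (\<Sum>i. B(X, F\<^sub>i) F\<^sub>i)\<close> and its trace is the sum of the \<open>B(F\<^sub>i, F\<^sub>i)\<close>; using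
  \<open>\<partial>\<^sub>y\<close> itself, and dividing by its squared length, avoids the square root. If \<open>B\<close> vanishes on
  the plane of \<open>\<partial>\<^sub>y\<close> and \<open>\<partial>\<^sub>p\<close>, then \<open>A\<close> maps this plane into the line of \<open>F\<close>, so it is
  singular.\<close>
lemma shape_operator_adapted_frame:
  fixes u :: "real^3" and p q s :: real and n :: "real^3 \<Rightarrow> real^'n::finite"
  assumes ind: "\<And>X Y. induced_metric g \<phi> u X Y =
      X$1 * Y$1 + (1 + s\<^sup>2) * ((X$2 - p * X$1) * (Y$2 - p * Y$1))
      + (X$3 - q * X$1) * (Y$3 - q * Y$1)"
    and B: "bilinear B"
      "\<And>X Y. g (\<phi> u) (second_fundamental_form g \<phi> u X Y) (n u) = B X Y"
  defines "F \<equiv> vector [1, p, q]"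
  shows "mean_curvature g \<phi> n u =
      (B F F + B (axis 2 1) (axis 2 1) / (1 + s\<^sup>2) + B (axis 3 1) (axis 3 1)) / 3"
    and "\<lbrakk>\<And>i j. i \<in> {2, 3} \<Longrightarrow> j \<in> {2, 3} \<Longrightarrow> B (axis i 1) (axis j 1) = 0\<rbrakk>
      \<Longrightarrow> gauss_kronecker g \<phi> n u = 0"
proof -
  define A where "A X = B X F *\<^sub>R F + (B X (axis 2 1) / (1 + s\<^sup>2)) *\<^sub>R axis 2 1
      + B X (axis 3 1) *\<^sub>R axis 3 1" for X
  have s: "1 + s\<^sup>2 > 0" by (simp add: add_pos_nonneg)
  have frame: "X = X$1 *\<^sub>R F + (X$2 - p * X$1) *\<^sub>R axis 2 1 + (X$3 - q * X$1) *\<^sub>R axis 3 1" for X :: "real^3"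
    by (simp add: F_def vec_eq_iff forall_3 axis_def)
  have BA: "B X Y = B X F * Y$1 + B X (axis 2 1) * (Y$2 - p * Y$1)
      + B X (axis 3 1) * (Y$3 - q * Y$1)" for X Y
    by (subst frame[of Y]) (simp add: bilinear_radd[OF B(1)] bilinear_rmul[OF B(1)] mult.commute)
  have shape: "shape_operator g \<phi> n u = A"
  proof (rule shape_operator_eqI)
    show "bilinear (induced_metric g \<phi> u)"
      by (simp add: bilinear_def linear_iff ind algebra_simps)
    show "induced_metric g \<phi> u X X > 0" if "X \<noteq> 0" for X
    proof (rule ccontr)
      assume "\<not> induced_metric g \<phi> u X X > 0"
      moreover have "induced_metric g \<phi> u X X = (X$1)\<^sup>2 + (1 + s\<^sup>2) * (X$2 - p * X$1)\<^sup>2 + (X$3 - q * X$1)\<^sup>2"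
        by (simp add: ind power2_eq_square)
      moreover have "(1 + s\<^sup>2) * (X$2 - p * X$1)\<^sup>2 \<ge> 0"
        using s by simp
      ultimately have *: "(X$1)\<^sup>2 = 0" "(1 + s\<^sup>2) * (X$2 - p * X$1)\<^sup>2 = 0" "(X$3 - q * X$1)\<^sup>2 = 0"
        using zero_le_power2[of "X$1"] zero_le_power2[of "X$3 - q * X$1"] by linarith+
      then have "X = 0"
        using s by (simp add: vec_eq_iff forall_3)
      with that show False ..
    qed
    show "linear A"
      unfolding A_def linear_iff
      by (simp add: bilinear_ladd[OF B(1)] bilinear_lmul[OF B(1)] algebra_simps add_divide_distrib)
    show "induced_metric g \<phi> u (A X) Y = g (\<phi> u) (second_fundamental_form g \<phi> u X Y) (n u)" for X Y
      unfolding B(2) BA[of X Y] ind A_def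
      using s by (simp add: F_def axis_def)
  qed
  have frameL: "B F X = B (axis 1 1) X + p * B (axis 2 1) X + q * B (axis 3 1) X" for X
  proof -
    have "F = axis 1 1 + p *\<^sub>R axis 2 1 + q *\<^sub>R axis 3 1"
      by (simp add: F_def vec_eq_iff forall_3 axis_def)
    then show ?thesis
      by (simp only: bilinear_ladd[OF B(1)] bilinear_lmul[OF B(1)]) simp
  qed
  show "mean_curvature g \<phi> n u =
      (B F F + B (axis 2 1) (axis 2 1) / (1 + s\<^sup>2) + B (axis 3 1) (axis 3 1)) / 3"
    unfolding mean_curvature_def shape trace_def
    by (simp add: sum_3 matrix_def A_def frameL) (simp add: F_def axis_def mult.commute)
  show "gauss_kronecker g \<phi> n u = 0"
    if "\<And>i j. i \<in> {2, 3} \<Longrightarrow> j \<in> {2, 3} \<Longrightarrow> B (axis i 1) (axis j 1) = 0"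
  proof -
    have "A (axis 2 1) = B (axis 2 1) F *\<^sub>R F" "A (axis 3 1) = B (axis 3 1) F *\<^sub>R F"
      using that by (simp_all add: A_def)
    then show ?thesis
      unfolding gauss_kronecker_def shape
      by (simp add: det_3 matrix_def algebra_simps)
  qed
qed

section \<open>Calculus of the function defining the section\<close>

text \<open>If the derivative of \<open>q\<close> along \<open>e\<close> vanishes on an open set, then so does the mixed second
  derivative taken in the order that differentiates along \<open>e\<close> last: \<open>q\<close> is invariant under small
  translations along \<open>e\<close>, hence so is its derivative.\<close>
lemma frechet_derivative_translation_invariant:
  fixes q :: "'a::real_normed_vector \<Rightarrow> 'b::real_normed_vector"
  assumes "open U" "u \<in> U" and diff: "\<And>v. v \<in> U \<Longrightarrow> q differentiable (at v)"
    and zero: "\<And>v. v \<in> U \<Longrightarrow> frechet_derivative q (at v) e = 0"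
    and T: "((\<lambda>v. frechet_derivative q (at v) Y) has_derivative T) (at u)"
  shows "T e = 0"
proof -
  obtain \<epsilon> where \<epsilon>: "\<epsilon> > 0" "ball u \<epsilon> \<subseteq> U"
    using assms(1,2) openE by blast
  \<comment> \<open>The added 1 keeps the bound meaningful for \<open>e = 0\<close>.\<close>
  define \<delta> where "\<delta> = \<epsilon> / (2 * (norm e + 1))"
  have "\<delta> > 0" using \<epsilon> by (simp add: \<delta>_def add_nonneg_pos)
  have small: "norm (t *\<^sub>R e) < \<epsilon> / 2" if "\<bar>t\<bar> < \<delta>" for t
  proof -
    have "\<bar>t\<bar> * norm e \<le> \<bar>t\<bar> * (norm e + 1)" by (simp add: mult_left_mono)
    also have "\<dots> < \<delta> * (norm e + 1)"
      using that by (intro mult_strict_right_mono) (auto simp: add_nonneg_pos)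
    also have "\<dots> = \<epsilon> / 2"
      by (simp add: \<delta>_def field_simps add_nonneg_eq_0_iff)
    finally show ?thesis by simp
  qed
  have const: "q (v + t *\<^sub>R e) = q v" if v: "v \<in> ball u (\<epsilon> / 2)" and t: "\<bar>t\<bar> < \<delta>" for v t
  proof -
    have "\<exists>c. \<forall>x\<in>{-\<delta><..<\<delta>}. q (v + x *\<^sub>R e) = c"
    proof (rule has_derivative_zero_constant)
      fix x assume x: "x \<in> {-\<delta><..<\<delta>}"
      have "v + x *\<^sub>R e \<in> U"
      proof -
        have "dist u (v + x *\<^sub>R e) \<le> dist u v + norm (x *\<^sub>R e)"
          using dist_triangle[of u "v + x *\<^sub>R e" v] by (simp add: dist_norm)
        also have "\<dots> < \<epsilon>" using small[of x] v x by (auto simp: abs_less_iff)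
        finally show ?thesis using \<epsilon>(2) by auto
      qed
      then have q: "(q has_derivative frechet_derivative q (at (v + x *\<^sub>R e))) (at (v + x *\<^sub>R e))"
        and 0: "frechet_derivative q (at (v + x *\<^sub>R e)) e = 0"
        using diff zero frechet_derivative_works by blast+
      have line: "((\<lambda>t. v + t *\<^sub>R e) has_derivative (\<lambda>h. h *\<^sub>R e)) (at x within {-\<delta><..<\<delta>})"
        by (auto intro!: derivative_eq_intros)
      from has_derivative_compose[OF line q]
      show "((\<lambda>t. q (v + t *\<^sub>R e)) has_derivative (\<lambda>h. 0)) (at x within {-\<delta><..<\<delta>})"
        using linear_cmul[OF has_derivative_linear[OF q]] 0 by simp
    qed simp
    then obtain c where "\<And>x. x \<in> {-\<delta><..<\<delta>} \<Longrightarrow> q (v + x *\<^sub>R e) = c"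
      by blast
    from this[of t] this[of 0] show ?thesis
      using t \<open>\<delta> > 0\<close> by (auto simp: abs_less_iff)
  qed
  have inv: "frechet_derivative q (at (u + t *\<^sub>R e)) = frechet_derivative q (at u)"
    if t: "\<bar>t\<bar> < \<delta>" for t
  proof -
    have "u + t *\<^sub>R e \<in> U"
      using \<epsilon> small[OF t] by (intro subsetD[OF \<epsilon>(2)]) (auto simp: dist_norm)
    then have q: "(q has_derivative frechet_derivative q (at (u + t *\<^sub>R e))) (at (u + t *\<^sub>R e))"
      using diff frechet_derivative_works by blast
    have "((\<lambda>v. v + t *\<^sub>R e) has_derivative (\<lambda>h. h)) (at u)"
      by (auto intro!: derivative_eq_intros)
    from has_derivative_compose[OF this q]
    have "((\<lambda>v. q (v + t *\<^sub>R e)) has_derivative frechet_derivative q (at (u + t *\<^sub>R e))) (at u)" .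
    then have "(q has_derivative frechet_derivative q (at (u + t *\<^sub>R e))) (at u)"
      by (rule has_derivative_transform_within_open[of _ _ _ _ "ball u (\<epsilon> / 2)"])
        (use \<epsilon> const t in auto)
    then show ?thesis by (rule frechet_derivative_at)
  qed
  have "((\<lambda>t. u + t *\<^sub>R e) has_derivative (\<lambda>h. h *\<^sub>R e)) (at 0)"
    by (auto intro!: derivative_eq_intros)
  moreover have "((\<lambda>v. frechet_derivative q (at v) Y) has_derivative T) (at (u + 0 *\<^sub>R e))"
    using T by simp
  ultimately have "((\<lambda>t. frechet_derivative q (at (u + t *\<^sub>R e)) Y) has_derivative (\<lambda>h. T (h *\<^sub>R e))) (at (0::real))"
    by (rule has_derivative_compose)
  then have "((\<lambda>t. frechet_derivative q (at u) Y) has_derivative (\<lambda>h. T (h *\<^sub>R e))) (at (0::real))"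
    by (rule has_derivative_transform_within_open[of _ _ _ _ "{-\<delta><..<\<delta>}"])
      (use \<open>\<delta> > 0\<close> inv in \<open>auto simp: abs_less_iff\<close>)
  from has_derivative_unique[OF this has_derivative_const] show ?thesis
    by (auto dest: fun_cong[of _ _ 1])
qed

lemma smooth_on_differentiable:
  assumes "smooth_on S F" "x \<in> S"
  shows "F differentiable (at x)"
proof -
  have "C_k_on (Suc 0) F S"
    using assms(1) unfolding smooth_on_def by blast
  then show ?thesis using assms(2) by simp
qed

lemma smooth_on_pd_differentiable:
  assumes "smooth_on S F" "x \<in> S"
  shows "pd i F differentiable (at x)"
proof -
  have "C_k_on (Suc (Suc 0)) F S"
    using assms(1) unfolding smooth_on_def by blast
  then have "(\<lambda>x. frechet_derivative F (at x) (axis i 1)) differentiable (at x)"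
    using assms(2) by simp
  then show ?thesis by (simp add: pd_def[abs_def])
qed

lemma frechet_derivative_eq_pd:
  fixes F :: "real^'n::finite \<Rightarrow> real"
  assumes "F differentiable (at x)"
  shows "frechet_derivative F (at x) X = (\<Sum>i\<in>UNIV. pd i F x * X$i)"
  using linear_axis_expansion[OF linear_frechet_derivative[OF assms], of X]
  by (simp add: pd_def mult.commute)

section \<open>Curvatures of the section\<close>

text \<open>Of the diagonal entries of the second fundamental form only that of \<open>\<partial>\<^sub>y\<close> survives. The entry
  of \<open>\<partial>\<^sub>p\<close> vanishes because \<open>q\<^sub>p\<close> is zero, and that of \<open>F\<close> vanishes by differentiating
  \<open>f \<circ> \<sigma> = q\<^sub>x + p q\<^sub>y\<close> along \<open>F\<close>: the extra term \<open>q q\<^sub>y\<close> from the derivative of the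
  coefficient \<open>p\<close> is the Koszul contribution of \<open>dy - p dx\<close>, and the derivative of \<open>f\<close> is that
  of \<open>dq - f dx\<close>. For the determinant the mixed entries of \<open>\<partial>\<^sub>y\<close> and \<open>\<partial>\<^sub>p\<close> must vanish as well, in
  both orders.\<close>
lemma ode_section_curvature:
  fixes f :: "real^4 \<Rightarrow> real" and q :: "real^3 \<Rightarrow> real" and n :: "real^3 \<Rightarrow> real^4"
  assumes "open U" and sq: "smooth_on U q"
    and fdiff: "f differentiable (at (ode_section q u))"
    and tangency: "\<forall>u\<in>U. f (ode_section q u) = pd 1 q u + u$3 * pd 2 q u + q u * pd 3 q u"
    and qp: "\<forall>u\<in>U. pd 3 q u = 0"
    and n: "normal_at (ode_metric f) (ode_section q) u (n u)"
      "ode_metric f (ode_section q u) (n u) (n u) = 1"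
    and u: "u \<in> U"
  shows "mean_curvature (ode_metric f) (ode_section q) n u =
      n u $ 4 * pd 2 (pd 2 q) u / (3 * (1 + (pd 2 q u)\<^sup>2))"
    and "n u $ 4 \<noteq> 0"
    and "pd 2 (pd 2 q) u = 0 \<Longrightarrow> gauss_kronecker (ode_metric f) (ode_section q) n u = 0"
proof -
  define r where "r = pd 1 q"
  define s where "s = pd 2 q"
  define R where "R = frechet_derivative r (at u)"
  define T where "T = frechet_derivative s (at u)"
  define f' where "f' = frechet_derivative f (at (ode_section q u))"
  have R: "(r has_derivative R) (at u)" and T: "(s has_derivative T) (at u)"
    using smooth_on_pd_differentiable[OF sq u] frechet_derivative_works
    by (auto simp: R_def T_def r_def s_def)
  have f': "(f has_derivative f') (at (ode_section q u))"
    using fdiff frechet_derivative_works by (auto simp: f'_def)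
  have q: "(q has_derivative (\<lambda>X. r v * X$1 + s v * X$2)) (at v)" if "v \<in> U" for v
  proof -
    have d: "q differentiable (at v)" by (rule smooth_on_differentiable[OF sq that])
    then have "frechet_derivative q (at v) = (\<lambda>X. r v * X$1 + s v * X$2)"
      using qp that by (simp add: fun_eq_iff frechet_derivative_eq_pd sum_3 r_def s_def)
    with d show ?thesis using frechet_derivative_works by metis
  qed
  note qu = q[OF u]
  have tan: "f (ode_section q v) = r v + v$3 * s v" if "v \<in> U" for v
    using tangency qp that by (simp add: r_def s_def)
  note tanu = tan[OF u]
  have dV: "((\<lambda>v. dmap (ode_section q) v Y) has_derivative
      (\<lambda>X. vector [0, 0, 0, R X * Y$1 + T X * Y$2])) (at u)" for Y
  proof (rule has_derivative_transform_within_open[OF _ \<open>open U\<close> u])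
    show "((\<lambda>v. vector [Y$1, Y$2, Y$3, r v * Y$1 + s v * Y$2] :: real^4) has_derivative
      (\<lambda>X. vector [0, 0, 0, R X * Y$1 + T X * Y$2])) (at u)"
      by (intro has_derivative_vector_4 has_derivative_const has_derivative_add
          has_derivative_mult_left R T)
  qed (simp add: dmap_ode_section[OF q])
  define B where "B X Y = n u$4 * (R X * Y$1 + T X * Y$2)
    + (n u$4 * (Y$1 * (s u * X$3 - f' (dmap (ode_section q) u X))
            + X$1 * (s u * Y$3 - f' (dmap (ode_section q) u Y))
            + X$1 * (Y$3 - q u * Y$1) + Y$1 * (X$3 - q u * X$1))
       + f' (n u) * s u * (X$1 * (Y$2 - u$3 * Y$1) + Y$1 * (X$2 - u$3 * X$1))) / 2" for X Y
  note lin = has_derivative_linear[OF R] has_derivative_linear[OF T]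
    has_derivative_linear[OF f'] linear_dmap_ode_section[OF qu]
  have B: "bilinear B"
    unfolding bilinear_def linear_iff B_def
    by (simp add: lin[THEN linear_add] lin[THEN linear_cmul] field_simps)
  have II: "ode_metric f (ode_section q u)
      (second_fundamental_form (ode_metric f) (ode_section q) u X Y) (n u) = B X Y" for X Y
    unfolding B_def by (rule second_form_ode_section[OF qu dV f' tanu n])
  note curvature = shape_operator_adapted_frame[of "ode_metric f" "ode_section q" u "s u" "u$3" "q u" B n,
      OF induced_metric_ode_section[of q "r u" "s u" u f, OF qu tanu] B II]
  define F where "F = (vector [1, u$3, q u] :: real^3)"
  have BFF: "B F F = 0"
  proof -
    have "((\<lambda>v. f (ode_section q v)) has_derivative (\<lambda>X. f' (dmap (ode_section q) u X))) (at u)"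
      unfolding dmap_ode_section[OF qu]
      by (rule has_derivative_compose[OF has_derivative_ode_section[OF qu] f'])
    moreover have "((\<lambda>v. f (ode_section q v)) has_derivative
        (\<lambda>X. R X + (u$3 * T X + X$3 * s u))) (at u)"
    proof (rule has_derivative_transform_within_open[OF _ \<open>open U\<close> u])
      show "((\<lambda>v. r v + v$3 * s v) has_derivative (\<lambda>X. R X + (u$3 * T X + X$3 * s u))) (at u)"
        by (intro has_derivative_add has_derivative_mult has_derivative_nth R T)
    qed (simp add: tan)
    ultimately have "(\<lambda>X. f' (dmap (ode_section q) u X)) = (\<lambda>X. R X + (u$3 * T X + X$3 * s u))"
      by (rule has_derivative_unique)
    then have "f' (dmap (ode_section q) u F) = R F + (u$3 * T F + q u * s u)"
      by (simp add: fun_eq_iff F_def)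
    then show ?thesis
      unfolding B_def by (simp add: F_def field_simps)
  qed
  have Bp: "B X (axis 3 1) = 0" if "X$1 = 0" for X
    using that by (simp add: B_def axis_def)
  have By: "B X (axis 2 1) = n u$4 * T X" if "X$1 = 0" for X
    using that by (simp add: B_def axis_def)
  have Tp: "T (axis 3 1) = 0"
  proof (rule frechet_derivative_translation_invariant[OF \<open>open U\<close> u])
    show "((\<lambda>v. frechet_derivative q (at v) (axis 2 1)) has_derivative T) (at u)"
      using T by (simp add: s_def pd_def[abs_def])
  qed (use smooth_on_differentiable[OF sq] qp in \<open>auto simp: pd_def\<close>)
  have Ty: "T (axis 2 1) = pd 2 (pd 2 q) u"
    by (simp add: T_def s_def pd_def)
  have ax: "(axis 2 1 :: real^3) $ 1 = 0" "(axis 3 1 :: real^3) $ 1 = 0"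
    by (simp_all add: axis_def)
  show "mean_curvature (ode_metric f) (ode_section q) n u =
      n u $ 4 * pd 2 (pd 2 q) u / (3 * (1 + (pd 2 q u)\<^sup>2))"
    unfolding curvature(1) F_def[symmetric]
    using BFF Bp By ax Ty by (simp add: s_def)
  show "gauss_kronecker (ode_metric f) (ode_section q) n u = 0" if "pd 2 (pd 2 q) u = 0"
    by (rule curvature(2)) (use Bp By ax Ty Tp that in auto)
  show "n u $ 4 \<noteq> 0"
  proof
    assume "n u $ 4 = 0"
    then have "n u = 0"
      using normal_ode_section[OF qu tanu n(1)] by (simp add: vec_eq_iff forall_4)
    then show False using n(2) by (simp add: ode_metric_eq)
  qed
qed

section \<open>Minimality and Gauss--Kronecker curvature\<close>

theorem mainTheorem1:
  fixes S :: "(real^4) set" and f :: "real^4 \<Rightarrow> real"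
    and U :: "(real^3) set" and q :: "real^3 \<Rightarrow> real"
    and n :: "real^3 \<Rightarrow> real^4"
  assumes "open S" and "smooth_on S f"
    and "open U" and "smooth_on U q"
    and "ode_section q ` U \<subseteq> S"
    and "\<forall>u\<in>U. f (ode_section q u) = pd 1 q u + u$3 * pd 2 q u + q u * pd 3 q u"
    and "\<forall>u\<in>U. pd 3 q u = 0"
    and "\<forall>u\<in>U. pd 2 q u \<noteq> 0"
    and "\<forall>z \<in> ode_section q ` U. pd 4 f z = 0"
    and "unit_normal_field (ode_metric f) (ode_section q) U n"
  shows "(minimal_hypersurface (ode_metric f) (ode_section q) U n \<longleftrightarrow>
            (\<forall>u\<in>U. pd 2 (pd 2 q) u = 0)) \<and>
         (minimal_hypersurface (ode_metric f) (ode_section q) U n \<longrightarrow>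
            (\<forall>u\<in>U. gauss_kronecker (ode_metric f) (ode_section q) n u = 0))"
proof -
  have fd: "f differentiable (at (ode_section q u))" if "u \<in> U" for u
    using smooth_on_differentiable[OF assms(2)] assms(5) that by blast
  have n: "normal_at (ode_metric f) (ode_section q) u (n u)"
      "ode_metric f (ode_section q u) (n u) (n u) = 1" if "u \<in> U" for u
    using assms(10) that by (auto simp: unit_normal_field_def)
  note curvature = ode_section_curvature[where n = n, OF assms(3,4) fd assms(6,7) n]
  have "mean_curvature (ode_metric f) (ode_section q) n u = 0 \<longleftrightarrow> pd 2 (pd 2 q) u = 0"
    if u: "u \<in> U" for u
  proof -
    have "3 * (1 + (pd 2 q u)\<^sup>2) \<noteq> 0"
      using add_pos_nonneg[OF zero_less_one zero_le_power2[of "pd 2 q u"]] by simp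
    then show ?thesis
      using curvature(1,2)[OF u u u u] by simp
  qed
  then have "minimal_hypersurface (ode_metric f) (ode_section q) U n \<longleftrightarrow>
      (\<forall>u\<in>U. pd 2 (pd 2 q) u = 0)"
    by (simp add: minimal_hypersurface_def)
  then show ?thesis
    using curvature(3) by blast
qed

end
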